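(* Let $\{X^t\}_{t\ge1}$ be the sequence of iterates generated by the FaNCL algorithm (described in the context) for the problem $\min_X F(X)\equiv f(X)+\lambda r(X)$, and let $X^*$ be the critical point of this problem to which $\{X^t\}$ converges. Then for every $T\ge1$, $$\min_{t=1,\dots,T}\|X^{t+1}-X^t\|_F^2\le\frac{1}{c_1T}\left[F(X^1)-F(X^* )\right].$$
   Context: Problem: $\min_{X\in\mathbb{R}^{m\times n}}F(X)\equiv f(X)+\lambda r(X)$, $m\le n$, $\lambda>0$, under the assumptions: (A1) $f$, not necessarily convex, is differentiable with $\rho$-Lipschitz gradient: $\|\nabla f(X_1)-\nabla f(X_2)\|_F\le\rho\|X_1-X_2\|_F$, with $\rho\le1$; (A2) $\inf f>-\infty$; (A3) $r(X)=\sum_{i=1}^m\hat r(\sigma_i)$, where $\sigma_1\ge\dots\ge\sigma_m\ge0$ are the singular values of $X$ and $\hat r$ is concave and non-decreasing on $[0,\infty)$ with $\hat r(0)=0$. Critical point: writing $r(X)=r_1(X)-r_2(X)$ with $r_1,r_2$ convex, $X^*$ is a critical point if $0\in\nabla f(X^* )+\lambda\partial r_1(X^* )-\lambda\partial r_2(X^* )$, where $\partial$ is the subdifferential. PowerMethod$(Z,R)$: set $Y^1=ZR$; for $s=1,\dots,T_{pm}$ let $Q^{s+1}$ be the orthonormal factor of the QR decomposition of $Y^s$ and $Y^{s+1}=Z(Z^\top Q^{s+1})$; return $Q^{T_{pm}+1}$. FaNCL algorithm: choose $\tau>\rho$, $c_1=\frac{\tau-\rho}{4}$, $\lambda^0>\lambda$,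 $\nu\in(0,1)$; initialize $V^0,V^1\in\mathbb{R}^{n\times k}$ as random Gaussian matrices and $X^1=0$. For $t=1,2,\dots$: set $\lambda^t=(\lambda^{t-1}-\lambda)\nu+\lambda$; $Z^t=X^t-\frac1\tau\nabla f(X^t)$; replace $V^{t-1}$ by $V^{t-1}-V^t((V^t)^\top V^{t-1})$ and remove zero columns; $R^1=\mathrm{QR}([V^t,V^{t-1}])$. Then for $p=1,2,\dots$: $Q=$ PowerMethod$(Z^t,R^p)$; compute the SVD $U_A^p\Sigma_A^p(V_A^p)^\top$ of $Q^\top Z^t$; let $\hat k$ be the number of its singular values larger than $\gamma$, where $\gamma>0$ is a threshold such that $\arg\min_{y\ge0}\frac12(y-\sigma)^2+\frac{\lambda^t}{\tau}\hat r(y)$ is $0$ for $\sigma\le\gamma$; let $\tilde U^p,\tilde V^p$ be the $\hat k$ leading columns of $U_A^p,V_A^p$; for $i\le\hat k$ let $y_i^*\in\arg\min_{y\ge0}\frac12(y-\sigma_i)^2+\frac{\lambda^t}{\tau}\hat r(y)$ with $\sigma_i$ the $i$-th singular value of $Q^\top Z^t$; set $\tilde X^p=(Q\tilde U^p)\mathrm{Diag}(y_1^*,\dots,y_{\hat k}^* )(\tilde V^p)^\top$. If $F(\tilde X^p)\le F(X^t)-c_1\|\tilde X^p-X^t\|_F^2$, set $X^{t+1}=\tilde X^p$, $V^{t+1}=\tilde V^p$ and exit the inner loop; otherwise set $R^{p+1}=V_A^p$ and continue with $p+1$. It is understood that the inner loop ends at each $t$, so each iteration satisfies the sufficient decrease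 $F(X^{t+1})\le F(X^t)-c_1\|X^{t+1}-X^t\|_F^2$. *)

theory Defs
  imports "HOL-Analysis.Analysis" "Jordan_Normal_Form.Char_Poly"
begin

no_notation Matrix.vec_index (infixl \<open>$\<close> 100)

(* The decision variable lives in the Euclidean space real^'n^'m, whose norm and inner product are
   the Frobenius ones.  All matrices whose number of columns changes while the algorithm runs are
   dimension-carrying matrices (type real mat).  The two representations are linked by numbering the
   finite index types with to_nat_on UNIV / from_nat_into UNIV, which are mutually inverse bijections
   between the type and {..<CARD}. *)

definition to_mat :: "real^'n^'m \<Rightarrow> real mat" where
  "to_mat X = Matrix.mat CARD('m) CARD('n)
     (\<lambda>(i, j). X $ from_nat_into (UNIV :: 'm set) i $ from_nat_into (UNIV :: 'n set) j)"

definition of_mat :: "real mat \<Rightarrow> real^'n^'m" where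
  "of_mat A = (\<chi> i j. A $$ (to_nat_on (UNIV :: 'm set) i, to_nat_on (UNIV :: 'n set) j))"

lemma of_mat_to_mat: "of_mat (to_mat X) = (X :: real^'n^'m)"
proof -
  have "to_nat_on (UNIV :: 'm set) i < CARD('m)" for i
    using to_nat_on_finite[of "UNIV :: 'm set"] by (auto simp: bij_betw_def)
  moreover have "to_nat_on (UNIV :: 'n set) j < CARD('n)" for j
    using to_nat_on_finite[of "UNIV :: 'n set"] by (auto simp: bij_betw_def)
  ultimately show ?thesis
    by (simp add: of_mat_def to_mat_def vec_eq_iff countable_finite)
qed

lemma to_mat_of_mat:
  assumes "A \<in> carrier_mat CARD('m) CARD('n)"
  shows "to_mat (of_mat A :: real^'n^'m) = A"
proof -
  have "to_nat_on (UNIV :: 'm set) (from_nat_into UNIV i) = i" if "i < CARD('m)" for i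
    by (metis finite bij_betw_imp_surj_on to_nat_on_finite lessThan_iff that to_nat_on_from_nat_into)
  moreover have "to_nat_on (UNIV :: 'n set) (from_nat_into UNIV j) = j" if "j < CARD('n)" for j
    by (metis finite bij_betw_imp_surj_on to_nat_on_finite lessThan_iff that to_nat_on_from_nat_into)
  ultimately show ?thesis
    using assms by (auto simp: of_mat_def to_mat_def)
qed

definition orthonormal_cols :: "real mat \<Rightarrow> bool" where
  "orthonormal_cols Q \<longleftrightarrow> Q\<^sup>T * Q = 1\<^sub>m (dim_col Q)"

(* Reduced factorisations.  Neither is unique, so both are relations. *)

definition QR_factor :: "real mat \<Rightarrow> real mat \<Rightarrow> bool" where
  "QR_factor A Q \<longleftrightarrow>
     (let d = min (dim_row A) (dim_col A) in
        Q \<in> carrier_mat (dim_row A) d \<and> orthonormal_cols Q \<and>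
        (\<exists>R \<in> carrier_mat d (dim_col A). upper_triangular R \<and> A = Q * R))"

definition SVD :: "real mat \<Rightarrow> real mat \<Rightarrow> real list \<Rightarrow> real mat \<Rightarrow> bool" where
  "SVD A U s V \<longleftrightarrow>
     (let d = min (dim_row A) (dim_col A) in
        U \<in> carrier_mat (dim_row A) d \<and> orthonormal_cols U \<and>
        V \<in> carrier_mat (dim_col A) d \<and> orthonormal_cols V \<and>
        length s = d \<and> sorted_wrt (\<ge>) s \<and> (\<forall>\<sigma> \<in> set s. 0 \<le> \<sigma>) \<and>
        A = U * mat_diag d (\<lambda>i. s ! i) * V\<^sup>T)"

(* Square roots of the eigenvalues of A A^T with multiplicity, in non-increasing order.
   Only meant for matrices with dim_row A \<le> dim_col A. *)
definition singular_values :: "real mat \<Rightarrow> real list" where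
  "singular_values A =
     rev (sorted_list_of_multiset (image_mset sqrt (proots (char_poly (A * A\<^sup>T)))))"

lemma proots_prod_linear: "proots (\<Prod>a\<leftarrow>xs. [:- a, 1:]) = mset (xs :: real list)"
proof (induction xs)
  case (Cons a xs)
  have "(\<Prod>a\<leftarrow>xs. [:- a, 1:]) \<noteq> 0" by (auto simp: prod_list_zero_iff)
  then have "proots ([:- a, 1:] * (\<Prod>a\<leftarrow>xs. [:- a, 1:])) = proots [:- a, 1:] + mset xs"
    by (subst proots_mult) (auto simp: Cons.IH)
  then show ?case by (simp add: proots_linear_factor del: mult_pCons_left)
qed simp

lemma singular_values_SVD:
  assumes "SVD A U s V" and "dim_row A \<le> dim_col A"
  shows "singular_values A = s"
proof -
  define d where "d = dim_row A"
  define n where "n = dim_col A"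
  define D where "D = mat_diag d (\<lambda>i. s ! i)"
  define E where "E = mat_diag d (\<lambda>i. s ! i * s ! i)"
  have d: "min (dim_row A) (dim_col A) = d" using assms(2) d_def by simp
  have U: "U \<in> carrier_mat d d" and oU: "U\<^sup>T * U = 1\<^sub>m d"
    and V: "V \<in> carrier_mat n d" and oV: "V\<^sup>T * V = 1\<^sub>m d"
    and ls: "length s = d" and so: "sorted_wrt (\<ge>) s" and nn: "\<forall>\<sigma>\<in>set s. 0 \<le> \<sigma>"
    and A: "A = U * D * V\<^sup>T"
    using assms(1) unfolding SVD_def Let_def d orthonormal_cols_def D_def
    by (auto simp: d_def n_def)
  have D: "D \<in> carrier_mat d d" by (simp add: D_def)
  have E: "E \<in> carrier_mat d d" by (simp add: E_def)
  have DT: "D\<^sup>T = D" unfolding D_def mat_diag_def by (rule eq_matI) auto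
  have DD: "D * D = E" unfolding D_def E_def by (rule mat_diag_diag)
  have AA: "A * A\<^sup>T = U * E * U\<^sup>T"
  proof -
    have c: "V\<^sup>T \<in> carrier_mat d n" "U\<^sup>T \<in> carrier_mat d d"
      "D * U\<^sup>T \<in> carrier_mat d d" "U * D \<in> carrier_mat d d"
      using U V D by auto
    have AT: "A\<^sup>T = V * (D * U\<^sup>T)"
      unfolding A transpose_mult[OF c(4) c(1)] transpose_mult[OF U D] DT by simp
    have "A * A\<^sup>T = (U * D) * (V\<^sup>T * (V * (D * U\<^sup>T)))"
      unfolding AT by (subst A) (rule assoc_mult_mat[OF c(4) c(1) mult_carrier_mat[OF V c(3)]])
    also have "V\<^sup>T * (V * (D * U\<^sup>T)) = (V\<^sup>T * V) * (D * U\<^sup>T)"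
      by (rule assoc_mult_mat[symmetric, OF c(1) V c(3)])
    also have "\<dots> = D * U\<^sup>T" unfolding oV by (rule left_mult_one_mat[OF c(3)])
    also have "(U * D) * (D * U\<^sup>T) = (U * D * D) * U\<^sup>T"
      by (rule assoc_mult_mat[symmetric, OF c(4) D c(2)])
    also have "U * D * D = U * E" unfolding assoc_mult_mat[OF U D D] DD ..
    finally show ?thesis .
  qed
  have UU: "U * U\<^sup>T = 1\<^sub>m d"
    by (rule mat_mult_left_right_inverse[OF _ U oU]) (use U in simp)
  have "similar_mat (A * A\<^sup>T) E"
    unfolding AA using U E oU UU by (intro similar_matI[of _ _ U "U\<^sup>T" d]) auto
  then have "char_poly (A * A\<^sup>T) = char_poly E" by (rule char_poly_similar)
  also have "\<dots> = (\<Prod>a \<leftarrow> diag_mat E. [:- a, 1:])"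
    by (rule char_poly_upper_triangular[OF E]) (auto simp: E_def mat_diag_def)
  also have "diag_mat E = map (\<lambda>x. x * x) s"
    by (rule nth_equalityI) (auto simp: E_def diag_mat_def mat_diag_def ls)
  finally have "proots (char_poly (A * A\<^sup>T)) = mset (map (\<lambda>x. x * x) s)"
    by (simp only: proots_prod_linear)
  moreover have "map sqrt (map (\<lambda>x. x * x) s) = s"
    using nn by (auto intro!: map_idI)
  ultimately have "image_mset sqrt (proots (char_poly (A * A\<^sup>T))) = mset s"
    by (metis mset_map)
  moreover have "sort s = rev s"
    using so by (intro properties_for_sort) (auto simp: sorted_wrt_rev)
  ultimately show ?thesis
    unfolding singular_values_def by simp
qed

definition spectral_reg :: "(real \<Rightarrow> real) \<Rightarrow> real^'n^'m \<Rightarrow> real" where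
  "spectral_reg rh X = (\<Sum>\<sigma> \<leftarrow> singular_values (to_mat X). rh \<sigma>)"

definition subdifferential :: "('a::real_inner \<Rightarrow> real) \<Rightarrow> 'a \<Rightarrow> 'a set" where
  "subdifferential g x = {u. \<forall>y. g x + inner u (y - x) \<le> g y}"

definition critical_point ::
  "('a::real_inner \<Rightarrow> 'a) \<Rightarrow> real \<Rightarrow> ('a \<Rightarrow> real) \<Rightarrow> ('a \<Rightarrow> real) \<Rightarrow> 'a \<Rightarrow> bool" where
  "critical_point gradf lam r1 r2 x \<longleftrightarrow>
     0 \<in> {gradf x + lam *\<^sub>R u1 - lam *\<^sub>R u2 | u1 u2.
            u1 \<in> subdifferential r1 x \<and> u2 \<in> subdifferential r2 x}"

(* y is a minimiser over [0, \<infinity>) of (y - \<sigma>)^2 / 2 + \<mu> rh y. *)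
definition prox_argmin :: "(real \<Rightarrow> real) \<Rightarrow> real \<Rightarrow> real \<Rightarrow> real \<Rightarrow> bool" where
  "prox_argmin rh \<mu> \<sigma> y \<longleftrightarrow>
     is_arg_min (\<lambda>y. 1/2 * (y - \<sigma>)\<^sup>2 + \<mu> * rh y) (\<lambda>y. 0 \<le> y) y"

definition hcat :: "real mat \<Rightarrow> real mat \<Rightarrow> real mat" where
  "hcat A B = mat_of_cols (dim_row A) (cols A @ cols B)"

definition remove_zero_cols :: "real mat \<Rightarrow> real mat" where
  "remove_zero_cols A = mat_of_cols (dim_row A) (filter (\<lambda>v. v \<noteq> 0\<^sub>v (dim_row A)) (cols A))"

definition leading_cols :: "nat \<Rightarrow> real mat \<Rightarrow> real mat" where
  "leading_cols k A = mat_of_cols (dim_row A) (take k (cols A))"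

(* The output is Q^{Tpm+1}; the intended range is Tpm \<ge> 1. *)
definition power_method :: "nat \<Rightarrow> real mat \<Rightarrow> real mat \<Rightarrow> real mat \<Rightarrow> bool" where
  "power_method Tpm Z R Q \<longleftrightarrow>
     (\<exists>Ys Qs. Ys 1 = Z * R \<and>
        (\<forall>s \<in> {1..Tpm}. QR_factor (Ys s) (Qs (s + 1)) \<and>
                        Ys (s + 1) = Z * (Z\<^sup>T * Qs (s + 1))) \<and>
        Q = Qs (Tpm + 1))"

(* One pass p of the inner loop, with \<mu> = \<lambda>^t / \<tau>: from R^p it computes the candidate Xc, the matrix
   Vc of leading right singular vectors, and VA = V_A^p, the starting matrix of the next pass. *)
definition candidate ::
  "nat \<Rightarrow> (real \<Rightarrow> real) \<Rightarrow> real \<Rightarrow> real \<Rightarrow> real mat \<Rightarrow> real mat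
    \<Rightarrow> real^'n^'m \<Rightarrow> real mat \<Rightarrow> real mat \<Rightarrow> bool" where
  "candidate Tpm rh \<mu> \<gamma> Z R Xc Vc VA \<longleftrightarrow>
     (\<exists>Q U s y. power_method Tpm Z R Q \<and>
        SVD (Q\<^sup>T * Z) U s VA \<and>
        (let kh = length (filter (\<lambda>\<sigma>. \<sigma> > \<gamma>) s) in
           (\<forall>i < kh. prox_argmin rh \<mu> (s ! i) (y i)) \<and>
           Vc = leading_cols kh VA \<and>
           Xc = of_mat ((Q * leading_cols kh U) * mat_diag kh y * Vc\<^sup>T)))"

(* inner_loop \<dots> R X' V': started from R, the inner loop terminates and returns (X', V'). *)
inductive inner_loop ::
  "(real^'n^'m \<Rightarrow> real) \<Rightarrow> real \<Rightarrow> nat \<Rightarrow> (real \<Rightarrow> real) \<Rightarrow> real \<Rightarrow> real \<Rightarrow> real mat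
    \<Rightarrow> real^'n^'m \<Rightarrow> real mat \<Rightarrow> real^'n^'m \<Rightarrow> real mat \<Rightarrow> bool"
  for F :: "real^'n^'m \<Rightarrow> real" and c1 :: real and Tpm :: nat and rh :: "real \<Rightarrow> real"
    and \<mu> \<gamma> :: real and Z :: "real mat" and X :: "real^'n^'m" where
  accept: "\<lbrakk>candidate Tpm rh \<mu> \<gamma> Z R Xc Vc VA;
            F Xc \<le> F X - c1 * (norm (Xc - X))\<^sup>2\<rbrakk>
           \<Longrightarrow> inner_loop F c1 Tpm rh \<mu> \<gamma> Z X R Xc Vc"
| reject: "\<lbrakk>candidate Tpm rh \<mu> \<gamma> Z R Xc Vc VA;
            \<not> F Xc \<le> F X - c1 * (norm (Xc - X))\<^sup>2;
            inner_loop F c1 Tpm rh \<mu> \<gamma> Z X VA X' V'\<rbrakk>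
           \<Longrightarrow> inner_loop F c1 Tpm rh \<mu> \<gamma> Z X R X' V'"

(* (lams, V, X) is a run of FaNCL.  The Gaussian matrices V 0, V 1 may be any realisation. *)
definition FaNCL_run ::
  "(real^'n^'m \<Rightarrow> real) \<Rightarrow> (real^'n^'m \<Rightarrow> real^'n^'m) \<Rightarrow> real \<Rightarrow> (real \<Rightarrow> real)
    \<Rightarrow> real \<Rightarrow> real \<Rightarrow> real \<Rightarrow> nat \<Rightarrow> nat \<Rightarrow> (nat \<Rightarrow> real)
    \<Rightarrow> (nat \<Rightarrow> real) \<Rightarrow> (nat \<Rightarrow> real mat) \<Rightarrow> (nat \<Rightarrow> real^'n^'m) \<Rightarrow> bool" where
  "FaNCL_run f gradf lam rh \<tau> c1 \<nu> k Tpm \<gamma> lams V X \<longleftrightarrow>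
     lam < lams 0 \<and>
     V 0 \<in> carrier_mat CARD('n) k \<and> V 1 \<in> carrier_mat CARD('n) k \<and> X 1 = 0 \<and>
     (\<forall>t \<ge> 1.
        lams t = (lams (t - 1) - lam) * \<nu> + lam \<and>
        (\<exists>R. QR_factor
               (hcat (V t) (remove_zero_cols (V (t - 1) - V t * ((V t)\<^sup>T * V (t - 1))))) R \<and>
             inner_loop (\<lambda>Y. f Y + lam * spectral_reg rh Y) c1 Tpm rh (lams t / \<tau>) (\<gamma> t)
               (to_mat (X t - (1 / \<tau>) *\<^sub>R gradf (X t))) (X t) R (X (t + 1)) (V (t + 1))))"

end

(* Summing the sufficient decrease over t = 1..T bounds c1 * T times the minimum by
   F(X^1) - F(X^{T+1}), and F(X^t) decreases to F(Xstar) because F is continuous: the regulariser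
   is a difference of finite convex functions on a finite-dimensional space, so no perturbation
   theory of singular values is needed. *)
theory Submission
  imports Defs
begin

text \<open>The loop can only be left through \<open>accept\<close>, whose guard is this inequality.
  In \<open>reject\<close> only the starting matrix changes, while \<open>F\<close>,
  \<open>c1\<close> and \<open>X\<close> stay fixed, so the bound passes through the induction as it
  is.\<close>

lemma inner_loop_sufficient_decrease:
  assumes "inner_loop F c1 Tpm rh \<mu> \<gamma> Z X R X' V'"
  shows "F X' \<le> F X - c1 * (norm (X' - X))\<^sup>2"
  using assms by induction auto

lemma FaNCL_run_sufficient_decrease:
  assumes "FaNCL_run f gradf lam rh \<tau> c1 \<nu> k Tpm \<gamma> lams V X" and "1 \<le> t"
  shows "f (X (Suc t)) + lam * spectral_reg rh (X (Suc t))
    \<le> f (X t) + lam * spectral_reg rh (X t) - c1 * (norm (X (Suc t) - X t))\<^sup>2"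
proof -
  obtain R where "inner_loop (\<lambda>Y. f Y + lam * spectral_reg rh Y) c1 Tpm rh (lams t / \<tau>) (\<gamma> t)
      (to_mat (X t - (1 / \<tau>) *\<^sub>R gradf (X t))) (X t) R (X (t + 1)) (V (t + 1))"
    using assms unfolding FaNCL_run_def by blast
  from inner_loop_sufficient_decrease[OF this] show ?thesis by simp
qed

text \<open>Telescoping argument detached from the algorithm: \<open>\<phi>\<close> stands for the
  objective along the iterates and \<open>L\<close> for its limit.\<close>

lemma Min_squared_steps_le:
  fixes x :: "nat \<Rightarrow> 'a::real_normed_vector" and \<phi> :: "nat \<Rightarrow> real"
  assumes c: "0 < c"
    and dec: "\<And>t. 1 \<le> t \<Longrightarrow> \<phi> (Suc t) \<le> \<phi> t - c * (norm (x (Suc t) - x t))\<^sup>2"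
    and lim: "\<phi> \<longlonglongrightarrow> L"
    and T: "1 \<le> T"
  shows "Min ((\<lambda>t. (norm (x (Suc t) - x t))\<^sup>2) ` {1..T}) \<le> 1 / (c * real T) * (\<phi> 1 - L)"
    (is "?m \<le> _")
proof -
  have "\<phi> (Suc t) \<le> \<phi> t" if "1 \<le> t" for t
    using dec[OF that] c by (smt (verit) mult_nonneg_nonneg zero_le_power2)
  \<comment> \<open>Decrease holds only from index 1 on, so monotonicity is stated for the shifted
    sequence; its entry at \<open>T\<close> is \<open>\<phi> (Suc T)\<close>, the end point of the
    telescoped sum.\<close>
  then have "decseq (\<lambda>t. \<phi> (Suc t))"
    by (intro decseq_SucI) simp
  then have L: "L \<le> \<phi> (Suc T)"
    using LIMSEQ_Suc[OF lim] by (rule decseq_ge)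
  \<comment> \<open>The left side is \<open>T\<close> copies of \<open>c * ?m\<close>, since the
    minimum lies below each squared step.\<close>
  have "(\<Sum>t=1..T. c * ?m) \<le> (\<Sum>t=1..T. \<phi> t - \<phi> (Suc t))"
  proof (rule sum_mono)
    fix t assume t: "t \<in> {1..T}"
    then have "c * ?m \<le> c * (norm (x (Suc t) - x t))\<^sup>2"
      using c by (intro mult_left_mono Min_le) auto
    then show "c * ?m \<le> \<phi> t - \<phi> (Suc t)"
      using dec[of t] t by simp
  qed
  also have "\<dots> = \<phi> 1 - \<phi> (Suc T)"
    \<comment> \<open>The negated sequence turns later-minus-earlier differences into the
      earlier-minus-later ones needed here.\<close>
    using sum_Suc_diff[of 1 T "\<lambda>t. - \<phi> t"] T by simp
  also have "\<dots> \<le> \<phi> 1 - L"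
    using L by simp
  finally show ?thesis
    using c T by (simp add: field_simps)
qed

theorem mainTheorem6:
  fixes f :: "real^'n^'m \<Rightarrow> real" and gradf :: "real^'n^'m \<Rightarrow> real^'n^'m"
    and r1 r2 F :: "real^'n^'m \<Rightarrow> real" and rh :: "real \<Rightarrow> real"
    and lam \<rho> \<tau> c1 \<nu> :: real and k Tpm T :: nat
    and \<gamma> lams :: "nat \<Rightarrow> real" and V :: "nat \<Rightarrow> real mat"
    and X :: "nat \<Rightarrow> real^'n^'m" and Xstar :: "real^'n^'m"
  assumes dims: "CARD('m) \<le> CARD('n)"
    and lam: "0 < lam"
    and F_def: "F = (\<lambda>Y. f Y + lam * spectral_reg rh Y)"
    and A1_grad: "\<And>Y. GDERIV f Y :> gradf Y"
    and A1_lipschitz: "\<rho>-lipschitz_on UNIV gradf" "\<rho> \<le> 1"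
    and A2: "bdd_below (range f)"
    and A3: "concave_on {0..} rh" "mono_on {0..} rh" "rh 0 = 0"
    and params: "\<rho> < \<tau>" "c1 = (\<tau> - \<rho>) / 4" "0 < \<nu>" "\<nu> < 1" "1 \<le> Tpm"
    and threshold: "\<And>t. 1 \<le> t \<Longrightarrow> 0 < \<gamma> t"
      "\<And>t \<sigma>. \<lbrakk>1 \<le> t; 0 \<le> \<sigma>; \<sigma> \<le> \<gamma> t\<rbrakk> \<Longrightarrow> prox_argmin rh (lams t / \<tau>) \<sigma> 0"
    and run: "FaNCL_run f gradf lam rh \<tau> c1 \<nu> k Tpm \<gamma> lams V X"
    and dc: "convex_on UNIV r1" "convex_on UNIV r2" "\<And>Y. spectral_reg rh Y = r1 Y - r2 Y"
    and conv: "X \<longlonglongrightarrow> Xstar"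
    and crit: "critical_point gradf lam r1 r2 Xstar"
    and T: "1 \<le> T"
  shows "Min ((\<lambda>t. (norm (X (t + 1) - X t))\<^sup>2) ` {1..T}) \<le> 1 / (c1 * real T) * (F (X 1) - F Xstar)"
proof -
  \<comment> \<open>\<open>UNIV\<close> is open, so there is no boundary at which a convex function
    could jump.\<close>
  have "continuous_on UNIV (\<lambda>Y. r1 Y - r2 Y)"
    using dc(1,2) by (intro continuous_on_diff convex_on_continuous) auto
  then have reg: "continuous_on UNIV (spectral_reg rh :: real^'n^'m \<Rightarrow> real)"
    using dc(3) by presburger
  have "continuous_on UNIV f"
    using A1_grad unfolding gderiv_def
    by (meson continuous_at_imp_continuous_on has_derivative_continuous)
  with reg have "continuous_on UNIV F"
    unfolding F_def by (intro continuous_intros)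
  then have "(\<lambda>t. F (X t)) \<longlonglongrightarrow> F Xstar"
    using conv by (rule continuous_on_tendsto_compose) auto
  moreover have "F (X (Suc t)) \<le> F (X t) - c1 * (norm (X (Suc t) - X t))\<^sup>2" if "1 \<le> t" for t
    using FaNCL_run_sufficient_decrease[OF run that] unfolding F_def .
  moreover have "0 < c1"
    using params by simp
  ultimately show ?thesis
    using Min_squared_steps_le[of c1 "\<lambda>t. F (X t)" X] T by simp
qed

end
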